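(* In the setting described in the context, for every $\alpha\in\mathbb{R}^N$ the $K\times K$ matrix $$M(\alpha)=\Pi_S'\,\mathrm{diag}(H\alpha)\,R_SR_S'\,\mathrm{diag}(H\alpha)\,\Pi_S,\qquad H=I_N-\Pi_S(\Pi_S'\Pi_S)^{-1}\Pi_S',$$ satisfies $M(\alpha)\,b=\mathbf{0}_K$. Therefore $b$ is an eigenvector of $M(\alpha)$ associated with the eigenvalue zero.
   Context: Fix $K\ge 2$ and $d\geq 1$, and let $v_1,\dots,v_K\in\mathbb{R}^d$ be the vertices of a simplex. A weight vector is a vector with nonnegative entries that sum to $1$. For $1\le i\le n$ let $w_i\in\mathbb{R}^K$ be a weight vector and $r_i=\sum_{k=1}^K w_i(k)v_k\in\mathbb{R}^d$. Let $S\subset\{1,\dots,n\}$ with $|S|=N$. For each $i\in S$ there is $\pi_i\in\mathbb{R}^K$ such that $w_i=(b\circ\pi_i)/\|b\circ\pi_i\|_1$, where $b\in\mathbb{R}^K$ is a vector with positive entries and $\|b\|=1$, and $\circ$ is the entrywise product. Let $\Pi_S\in\mathbb{R}^{N\times K}$ and $R_S\in\mathbb{R}^{N\times d}$ be the matrices whose rows are $\pi_i'$ and $r_i'$ ($i\in S$), respectively. It is assumed that $\Pi_S'\Pi_S$ is invertible, so that $H$ is well defined. For a vector $v$, $\mathrm{diag}(v)$ is the diagonal matrix with diagonal $v$; a prime denotes transpose. *)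

theory Defs
  imports "HOL-Analysis.Analysis"
begin

definition weight_vector :: "real ^ 'k \<Rightarrow> bool" where
  "weight_vector w \<longleftrightarrow> (\<forall>k. 0 \<le> w $ k) \<and> (\<Sum>k\<in>UNIV. w $ k) = 1"

definition simplex_vertices :: "('k \<Rightarrow> real ^ 'd) \<Rightarrow> bool" where
  "simplex_vertices v \<longleftrightarrow> inj v \<and> \<not> affine_dependent (range v)"

definition l1_norm :: "real ^ 'k \<Rightarrow> real" where
  "l1_norm x = (\<Sum>k\<in>UNIV. \<bar>x $ k\<bar>)"

definition diag :: "real ^ 'm \<Rightarrow> real ^ 'm ^ 'm" where
  "diag x = (\<chi> i j. if i = j then x $ i else 0)"

(* The rows are the vectors x i for i in a finite set S of naturals. The index type 'm plays the
   role of {1..N}; s is a bijection from it onto S, and row j is x (s j). *)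
definition row_matrix :: "('m \<Rightarrow> nat) \<Rightarrow> (nat \<Rightarrow> real ^ 'c) \<Rightarrow> real ^ 'c ^ 'm" where
  "row_matrix s x = (\<chi> j. x (s j))"

(* Meaningful only if transpose P ** P is invertible; otherwise matrix_inv is unspecified. *)
definition resid_proj :: "real ^ 'k ^ 'm \<Rightarrow> real ^ 'm ^ 'm" where
  "resid_proj P = mat 1 - P ** matrix_inv (transpose P ** P) ** transpose P"

definition M_matrix :: "real ^ 'k ^ 'm \<Rightarrow> real ^ 'd ^ 'm \<Rightarrow> real ^ 'm \<Rightarrow> real ^ 'k ^ 'k" where
  "M_matrix P R \<alpha> =
     transpose P ** diag (resid_proj P *v \<alpha>) ** R ** transpose R ** diag (resid_proj P *v \<alpha>) ** P"

definition eigenvector :: "real ^ 'k ^ 'k \<Rightarrow> real ^ 'k \<Rightarrow> real \<Rightarrow> bool" where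
  "eigenvector A x c \<longleftrightarrow> x \<noteq> 0 \<and> A *v x = c *\<^sub>R x"

end

(* Write h = H \<alpha>. The columns of \<Pi> are orthogonal to h. Since w_i sums to 1, the inner product of
   \<pi>_i and b equals the normalising constant of w_i, so (\<pi>_i . b) r_i = \<Sum>k. b_k \<pi>_i(k) v_k. Hence
   R' diag(h) \<Pi> b = \<Sum>k. b_k (\<Sum>i. h_i \<pi>_i(k)) v_k, where every inner sum vanishes. *)
theory Submission
  imports Defs
begin

text \<open>The Gram matrix cancels against its inverse, so right multiplication by the projection
  onto the column space of \<open>P\<close> fixes \<open>transpose P\<close>, and right
  multiplication by the complementary projection kills it.\<close>

lemma transpose_resid_proj:
  fixes P :: "real ^ 'k ^ 'm"
  assumes "invertible (transpose P ** P)"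
  shows "transpose P *v (resid_proj P *v \<alpha>) = 0"
proof -
  let ?G = "transpose P ** P"
  have "transpose P ** (P ** matrix_inv ?G ** transpose P) = (?G ** matrix_inv ?G) ** transpose P"
    by (simp add: matrix_mul_assoc)
  \<comment> \<open>\<open>matrix_inv\<close> is a Hilbert choice; invertibility provides the
    witness that makes the chosen matrix an inverse.\<close>
  also have "\<dots> = transpose P"
    using someI_ex [OF assms [unfolded invertible_def]] by (simp add: matrix_inv_def)
  finally have "transpose P ** (P ** matrix_inv ?G ** transpose P) = transpose P" .
  \<comment> \<open>The two complementary projections add up to the identity; distributing and
    cancelling \<open>transpose P\<close> isolates the residual part.\<close>
  moreover have "transpose P ** (resid_proj P + P ** matrix_inv ?G ** transpose P) = transpose P"
    by (simp add: resid_proj_def)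
  ultimately have "transpose P ** resid_proj P = 0"
    by (simp add: matrix_add_ldistrib)
  then show ?thesis
    by (simp add: matrix_vector_mul_assoc)
qed

lemma diag_mult_vec: "diag x *v y = x * y"
  by (simp add: vec_eq_iff diag_def matrix_vector_mult_def if_distrib [of "\<lambda>u. u * _"] cong: if_cong)

text \<open>Summing the entries of \<open>w\<close> gives \<open>1 = (p \<bullet> b) / c\<close>, so
  the factor \<open>p \<bullet> b\<close> undoes the normalisation. The scalar \<open>c\<close>
  stands for the l1 norm and is identified by this sum, whatever the signs in
  \<open>p\<close>.\<close>

lemma inner_scaled_normalized_combination:
  fixes v :: "'k::finite \<Rightarrow> 'a::real_vector" and b p w :: "real ^ 'k"
  assumes "weight_vector w" and w: "w = (b * p) /\<^sub>R c"
  shows "(p \<bullet> b) *\<^sub>R (\<Sum>k\<in>UNIV. w $ k *\<^sub>R v k) = (\<Sum>k\<in>UNIV. (b $ k * p $ k) *\<^sub>R v k)"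
proof -
  have "1 = (\<Sum>k\<in>UNIV. w $ k)"
    using assms(1) by (simp add: weight_vector_def)
  also have "\<dots> = (p \<bullet> b) / c"
    by (simp add: w inner_vec_def sum_distrib_left divide_inverse mult.commute)
  \<comment> \<open>Division by zero yields 0, so a quotient equal to 1 excludes
    \<open>c = 0\<close>.\<close>
  finally have "c \<noteq> 0" "p \<bullet> b = c"
    by (auto simp: field_simps split: if_splits)
  then show ?thesis
    by (simp add: w scaleR_sum_right mult.assoc [symmetric])
qed

theorem theorem2p1:
  fixes v :: "'k::finite \<Rightarrow> real ^ 'd::finite"
    and n :: nat
    and w \<pi> :: "nat \<Rightarrow> real ^ 'k"
    and r :: "nat \<Rightarrow> real ^ 'd"
    and b :: "real ^ 'k"
    and S :: "nat set"
    and s :: "'m::finite \<Rightarrow> nat"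
    and \<alpha> :: "real ^ 'm"
  assumes "CARD('k) \<ge> 2"
    and "simplex_vertices v"
    and "\<forall>i\<in>{1..n}. weight_vector (w i)"
    and "\<forall>i\<in>{1..n}. r i = (\<Sum>k\<in>UNIV. w i $ k *\<^sub>R v k)"
    and "S \<subseteq> {1..n}"
    and "bij_betw s UNIV S"
    and "\<forall>k. 0 < b $ k"
    and "norm b = 1"
    and "\<forall>i\<in>S. w i = (b * \<pi> i) /\<^sub>R l1_norm (b * \<pi> i)"
    and "invertible (transpose (row_matrix s \<pi>) ** row_matrix s \<pi>)"
  shows "M_matrix (row_matrix s \<pi>) (row_matrix s r) \<alpha> *v b = 0
       \<and> eigenvector (M_matrix (row_matrix s \<pi>) (row_matrix s r) \<alpha>) b 0"
proof -
  let ?P = "row_matrix s \<pi>" and ?R = "row_matrix s r"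
  define h where "h = resid_proj ?P *v \<alpha>"
  have orth: "(\<Sum>j\<in>UNIV. h $ j * \<pi> (s j) $ k) = 0" for k
    using transpose_resid_proj [OF assms(10), of \<alpha>, folded h_def]
    by (simp add: vec_eq_iff matrix_vector_mult_def transpose_def row_matrix_def mult.commute)
  have row: "(\<pi> (s j) \<bullet> b) *\<^sub>R r (s j) = (\<Sum>k\<in>UNIV. (b $ k * \<pi> (s j) $ k) *\<^sub>R v k)" for j
  proof -
    have "s j \<in> S"
      using assms(6) by (auto simp: bij_betw_def)
    then have j: "s j \<in> S" "s j \<in> {1..n}"
      using assms(5) by blast+
    show ?thesis
      using inner_scaled_normalized_combination [OF bspec [OF assms(3) j(2)] bspec [OF assms(9) j(1)]] assms(4) j(2)
      by simp
  qed
  \<comment> \<open>Entry \<open>j\<close> of \<open>?P *v b\<close> is the scalar in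
    \<open>row\<close>; the grouping lets \<open>row\<close> rewrite each term.\<close>
  have "transpose ?R *v (diag h *v (?P *v b)) = (\<Sum>j\<in>UNIV. h $ j *\<^sub>R ((\<pi> (s j) \<bullet> b) *\<^sub>R r (s j)))"
    by (simp add: vec_eq_iff diag_mult_vec transpose_def row_matrix_def matrix_vector_mul_component
        inner_vec_def [of _ "h * _"] mult_ac)
  also have "\<dots> = (\<Sum>j\<in>UNIV. \<Sum>k\<in>UNIV. (b $ k * (h $ j * \<pi> (s j) $ k)) *\<^sub>R v k)"
    by (simp add: row scaleR_sum_right mult_ac)
  \<comment> \<open>Summing over \<open>j\<close> first isolates, for each vertex, the sum that
    vanishes by \<open>orth\<close>.\<close>
  also have "\<dots> = (\<Sum>k\<in>UNIV. (b $ k * (\<Sum>j\<in>UNIV. h $ j * \<pi> (s j) $ k)) *\<^sub>R v k)"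
    by (subst sum.swap) (simp add: scaleR_sum_left sum_distrib_left)
  finally have "transpose ?R *v (diag h *v (?P *v b)) = 0"
    by (simp add: orth)
  \<comment> \<open>Applying the factors of the matrix to \<open>b\<close> one by one from the right
    passes through this zero vector.\<close>
  then have "M_matrix ?P ?R \<alpha> *v b = 0"
    by (simp add: M_matrix_def h_def matrix_vector_mul_assoc [symmetric] del: matrix_vector_mul_assoc)
  moreover have "b \<noteq> 0"
    using assms(8) by auto
  ultimately show ?thesis
    by (simp add: eigenvector_def)
qed

end
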